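(* Let $X$ be any Hausdorff space and set $\kappa = \widehat{F}(X) \cdot \widehat{\mu}(X)$. Then for every infinite cardinal $\varrho$ satisfying $\varrho^{<\kappa} = \varrho$ we have $L(X_{<\kappa}) \le \varrho$.
   Context: A transfinite sequence $\langle x_\alpha : \alpha < \eta\rangle$ of points of a topological space $X$ is a free sequence in $X$ if $\overline{\{x_\alpha : \alpha < \beta\}} \cap \overline{\{x_\alpha : \alpha \ge \beta\}} = \emptyset$ for each $\beta < \eta$ (closures in $X$). A subset $S \subset X$ is free in $X$ if it admits a well-ordering (equivalently, an indexing by ordinals) that turns it into a free sequence in $X$. $\mathcal{F}(X)$ denotes the collection of all free subsets in $X$. $\widehat{F}(X)$ is the smallest cardinal $\varphi$ such that $|S| < \varphi$ for all $S \in \mathcal{F}(X)$. $\widehat{\mu}(X)$ is the smallest cardinal $\mu$ such that for every $S \in \mathcal{F}(X)$ and every cover $\mathcal{U}$ of $\overline{S}$ by open sets there is $\mathcal{V} \subset \mathcal{U}$ with $|\mathcal{V}| < \mu$ that also covers $\overline{S}$. For a cardinal $\kappa$, $X_{<\kappa}$ is the set $X$ with the topology generated by all $G_{<\kappa}$-sets in $X$, i.e. sets obtainable as intersections of fewer than $\kappa$ open subsets of $X$. $L(Y)$ is the Lindelöf number of a space $Y$: the smallest infinite cardinal $\lambda$ such that every open cover of $Y$ has a subcover of size $\le \lambda$. Also $\varrho^{<\kappa} = \sup\{\varrho^{\nu} : \nu < \kappa,\ \nu \text{ a cardinal}\}$. *)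

theory Defs
  imports "HOL-Analysis.T1_Spaces"
begin

unbundle cardinal_syntax

text \<open>
  Cardinals are the \<^const>\<open>Card_order\<close> relations of \<^theory>\<open>HOL.BNF_Cardinal_Order_Relation\<close>, which
  represent a cardinal up to \<open>=o\<close>; only \<open>=o\<close>-invariant properties of them are used.
  Finite cardinals, including zero, are among them.

  The smallest cardinal with a given property is sought among the relations on a fixed
  type \<open>'b\<close>. Each use below instantiates \<open>'b\<close> by a type so large that some cardinal on it has the
  property; \<open>card_least_le\<close> then gives minimality among cardinals on arbitrary types.
\<close>

definition card_least :: "('b rel \<Rightarrow> bool) \<Rightarrow> 'b rel" where
  "card_least P = (SOME c. Card_order c \<and> P c \<and> (\<forall>d. Card_order d \<and> P d \<longrightarrow> c \<le>o d))"

lemma card_least: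
  assumes "Card_order c" "P c"
  shows "Card_order (card_least P)" "P (card_least P)"
    and "\<And>d. Card_order d \<Longrightarrow> P d \<Longrightarrow> card_least P \<le>o d"
proof -
  have "\<exists>c. Card_order c \<and> P c \<and> (\<forall>d. Card_order d \<and> P d \<longrightarrow> c \<le>o d)"
    using exists_minim_Card_order[of "{c. Card_order c \<and> P c}"] assms by blast
  from someI_ex[OF this]
  show "Card_order (card_least P)" "P (card_least P)"
    "\<And>d. Card_order d \<Longrightarrow> P d \<Longrightarrow> card_least P \<le>o d"
    unfolding card_least_def by blast+
qed

lemma card_least_le:
  fixes P :: "'b rel \<Rightarrow> bool" and d :: "'d rel"
  assumes c: "Card_order c" "P c"
    and d: "Card_order d" "\<And>d'. Card_order d' \<Longrightarrow> d' =o d \<Longrightarrow> P d'"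
  shows "card_least P \<le>o d"
proof (cases "|UNIV :: 'b set| \<le>o d")
  case True
  have "card_least P =o |Field (card_least P)|"
    by (rule ordIso_symmetric[OF card_of_Field_ordIso[OF card_least(1)[where P = P, OF c]]])
  also have "|Field (card_least P)| \<le>o |UNIV :: 'b set|"
    by (simp add: card_of_mono1)
  also have "|UNIV :: 'b set| \<le>o d"
    by (rule True)
  finally show ?thesis .
next
  case False
  then have "\<not> |UNIV :: 'b set| \<le>o |Field d|"
    using ordLeq_ordIso_trans[OF _ card_of_Field_ordIso[OF d(1)]] by blast
  then have "|Field d| \<le>o |UNIV :: 'b set|"
    using ordLeq_total[OF card_of_Well_order card_of_Well_order] by blast
  then obtain B :: "'b set" where B: "|Field d| =o |B|"
    using internalize_card_of_ordLeq2[of "Field d" "UNIV :: 'b set"] by blast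
  have *: "|B| =o d"
    by (rule ordIso_transitive[OF ordIso_symmetric[OF B] card_of_Field_ordIso[OF d(1)]])
  have "P |B|"
    by (rule d(2)[OF card_of_Card_order *])
  then have "card_least P \<le>o |B|"
    by (rule card_least(3)[where P = P, OF c card_of_Card_order])
  then show ?thesis
    using * by (rule ordLeq_ordIso_trans)
qed

definition card_sup :: "'b rel set \<Rightarrow> 'b rel" where
  "card_sup R = card_least (\<lambda>c. \<forall>r\<in>R. r \<le>o c)"

definition cexp_less :: "'r rel \<Rightarrow> 'k rel \<Rightarrow> ('k \<Rightarrow> 'r) rel"  (infixr \<open>^<c\<close> 90) where
  "\<rho> ^<c \<kappa> = card_sup {\<rho> ^c \<nu> | \<nu> :: 'k rel. Card_order \<nu> \<and> \<nu> <o \<kappa>}"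

text \<open>
  A sequence of type \<open>\<eta>\<close> is a function on the field of a well-order \<open>r\<close> of order type \<open>\<eta>\<close>.
\<close>

definition free_sequence :: "'a topology \<Rightarrow> 'i rel \<Rightarrow> ('i \<Rightarrow> 'a) \<Rightarrow> bool" where
  "free_sequence X r x \<longleftrightarrow>
     Well_order r \<and> x ` Field r \<subseteq> topspace X \<and>
     (\<forall>\<beta>\<in>Field r. X closure_of (x ` underS r \<beta>) \<inter> X closure_of (x ` above r \<beta>) = {})"

definition free_in :: "'a topology \<Rightarrow> 'a set \<Rightarrow> bool" where
  "free_in X S \<longleftrightarrow>
     S \<subseteq> topspace X \<and> (\<exists>r. well_order_on S r \<and> free_sequence X r (\<lambda>s. s))"

definition F_hat :: "'a topology \<Rightarrow> 'a set rel" where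
  "F_hat X = card_least (\<lambda>\<phi>. \<forall>S. free_in X S \<longrightarrow> |S| <o \<phi>)"

definition mu_hat :: "'a topology \<Rightarrow> 'a set rel" where
  "mu_hat X = card_least (\<lambda>\<mu>. \<forall>S \<U>.
     free_in X S \<and> (\<forall>U\<in>\<U>. openin X U) \<and> X closure_of S \<subseteq> \<Union>\<U> \<longrightarrow>
     (\<exists>\<V>\<subseteq>\<U>. |\<V>| <o \<mu> \<and> X closure_of S \<subseteq> \<Union>\<V>))"

definition G_less :: "'a topology \<Rightarrow> 'k rel \<Rightarrow> 'a set \<Rightarrow> bool" where
  "G_less X \<kappa> G \<longleftrightarrow>
     (\<exists>\<U>. |\<U>| <o \<kappa> \<and> (\<forall>U\<in>\<U>. openin X U) \<and> G = topspace X \<inter> \<Inter>\<U>)"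

text \<open>
  The whole space is itself a \<open>G_less\<close> set unless \<open>\<kappa>\<close> is zero; inserting it keeps the underlying
  set equal to that of \<open>X\<close> in this degenerate case too.
\<close>

definition G_less_topology :: "'a topology \<Rightarrow> 'k rel \<Rightarrow> 'a topology" where
  "G_less_topology X \<kappa> = topology_generated_by (insert (topspace X) {G. G_less X \<kappa> G})"

definition lindelof_number :: "'a topology \<Rightarrow> ('a + nat) rel" where
  "lindelof_number Y = card_least (\<lambda>l. Cinfinite l \<and>
     (\<forall>\<U>. (\<forall>U\<in>\<U>. openin Y U) \<and> \<Union>\<U> = topspace Y \<longrightarrow>
       (\<exists>\<V>\<subseteq>\<U>. |\<V>| \<le>o l \<and> \<Union>\<V> = topspace Y)))"

text \<open>In each of the four uses of \<^const>\<open>card_least\<close> the chosen type is large enough.\<close>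

lemma card_sup_exists:
  fixes R :: "'b rel set"
  assumes "\<And>r. r \<in> R \<Longrightarrow> Card_order r"
  shows "\<forall>r\<in>R. r \<le>o |UNIV :: 'b set|"
proof
  fix r assume "r \<in> R"
  then have "r =o |Field r|"
    by (intro ordIso_symmetric[OF card_of_Field_ordIso] assms)
  then show "r \<le>o |UNIV :: 'b set|"
    by (rule ordIso_ordLeq_trans[OF _ card_of_mono1[OF subset_UNIV]])
qed

lemma card_of_less_set_UNIV: "|A| <o |UNIV :: 'a set set|" for A :: "'a set"
  using ordLeq_ordLess_trans[OF card_of_mono1[OF subset_UNIV] card_of_Pow[of UNIV]] by simp

lemma F_hat_exists: "free_in X S \<Longrightarrow> |S| <o |UNIV :: 'a set set|" for X :: "'a topology"
  by (rule card_of_less_set_UNIV)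

lemma subcover_exists:
  assumes "A \<subseteq> \<Union>\<U>"
  shows "\<exists>\<V>\<subseteq>\<U>. |\<V>| \<le>o |A| \<and> A \<subseteq> \<Union>\<V>"
proof -
  obtain f where f: "\<And>a. a \<in> A \<Longrightarrow> a \<in> f a \<and> f a \<in> \<U>"
    using bchoice[of A "\<lambda>a U. a \<in> U \<and> U \<in> \<U>"] assms by blast
  then have "f ` A \<subseteq> \<U>" "A \<subseteq> \<Union>(f ` A)"
    by auto
  then show ?thesis
    using card_of_image by blast
qed

lemma mu_hat_exists:
  fixes X :: "'a topology"
  assumes "X closure_of S \<subseteq> \<Union>\<U>"
  shows "\<exists>\<V>\<subseteq>\<U>. |\<V>| <o |UNIV :: 'a set set| \<and> X closure_of S \<subseteq> \<Union>\<V>"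
proof -
  have "|X closure_of S| <o |UNIV :: 'a set set|"
    by (rule card_of_less_set_UNIV)
  with subcover_exists[OF assms] show ?thesis
    by (metis ordLeq_ordLess_trans)
qed

lemma lindelof_number_exists:
  fixes Y :: "'a topology"
  shows "Cinfinite |UNIV :: ('a + nat) set|"
    and "\<Union>\<U> = topspace Y \<Longrightarrow>
      \<exists>\<V>\<subseteq>\<U>. |\<V>| \<le>o |UNIV :: ('a + nat) set| \<and> \<Union>\<V> = topspace Y"
proof -
  show "Cinfinite |UNIV :: ('a + nat) set|"
    by (simp add: cinfinite_def Field_card_of card_of_card_order_on)
  assume U: "\<Union>\<U> = topspace Y"
  have "|topspace Y| \<le>o |UNIV :: ('a + nat) set|"
    by (rule card_of_ordLeqI[of Inl]) auto
  moreover obtain \<V> where "\<V> \<subseteq> \<U>" "|\<V>| \<le>o |topspace Y|" "topspace Y \<subseteq> \<Union>\<V>"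
    using subcover_exists[of "topspace Y" \<U>] U by auto
  moreover from this have "\<Union>\<V> = topspace Y"
    using U by blast
  ultimately show "\<exists>\<V>\<subseteq>\<U>. |\<V>| \<le>o |UNIV :: ('a + nat) set| \<and> \<Union>\<V> = topspace Y"
    by (metis ordLeq_transitive)
qed

lemma topspace_G_less_topology: "topspace (G_less_topology X \<kappa>) = topspace X"
  unfolding G_less_topology_def topology_generated_by_topspace by (auto simp: G_less_def)

end

theory Submission
  imports Defs
begin

text \<open>
  The argument is a closing-off (elementary submodel) argument along a regular cardinal \<open>\<theta>\<close>, where
  \<open>\<theta> = \<kappa>\<close> if \<open>\<kappa>\<close> is regular and \<open>\<theta> = \<kappa>\<^sup>+\<close> otherwise; in the singular case \<open>\<rho>\<^sup>\<kappa> = \<rho>\<close> follows by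
  splitting \<open>\<kappa>\<close> along a short cofinal set. Call sets of size less than \<open>\<theta>\<close> small.

  Suppose \<open>S\<close> is free and \<open>q\<close> lies in the closure of \<open>S\<close> and in a member \<open>U\<close> of the cover, an
  intersection of a small family of open sets. As \<open>X\<close> is Hausdorff, the closures of the traces
  \<open>S \<inter> W\<close>, with \<open>W\<close> an open neighbourhood of \<open>q\<close>, meet in \<open>{q}\<close>; so a small family of subsets of
  \<open>S\<close> has closures whose intersection contains \<open>q\<close> and lies in \<open>U\<close>. Hence \<open>U\<close> can be replaced by a
  member of the cover that is a function of this small family of small sets.

  Choose \<open>Y\<close> of size at most \<open>\<rho>\<close> closed under picking points outside small unions of the open
  sets that define the cover members obtained from \<open>Y\<close> in this way. If these members missed a point
  \<open>p\<close>, then the open sets missing \<open>p\<close> among their defining sets would cover the closure of every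
  free subset of \<open>Y\<close>, while no small number of them covers \<open>Y\<close>. A recursion of length \<open>\<theta>\<close> would
  then produce a free sequence in \<open>Y\<close> that is too long.
\<close>

section \<open>Cardinal arithmetic and closing off\<close>

text \<open>Usually written \<open>[A]^{<\<theta>}\<close>.\<close>

definition Pow_less :: "'k rel \<Rightarrow> 'a set \<Rightarrow> 'a set set" where
  "Pow_less \<theta> A = {B. B \<subseteq> A \<and> |B| <o \<theta>}"

lemma Pow_less_mono: "A \<subseteq> B \<Longrightarrow> Pow_less \<theta> A \<subseteq> Pow_less \<theta> B"
  by (auto simp: Pow_less_def)

lemma card_of_image_less: "|A| <o r \<Longrightarrow> |f ` A| <o r"
  using ordLeq_ordLess_trans[OF card_of_image] .

lemma card_of_subset_less: "|A| <o r \<Longrightarrow> B \<subseteq> A \<Longrightarrow> |B| <o r"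
  using ordLeq_ordLess_trans[OF card_of_mono1] .

lemma finite_card_less: "Cinfinite r \<Longrightarrow> finite A \<Longrightarrow> |A| <o r"
  by (intro Cfinite_ordLess_Cinfinite) (auto simp: cfinite_def Field_card_of card_of_card_order_on)

text \<open>The well-order \<open>|B|\<close> is isomorphic to a proper initial segment of
  \<open>\<theta>\<close>. In this way a small set of any type is traded for an initial segment, so
  that a property of the segments speaks about all small sets.\<close>

lemma card_less_underS:
  assumes "Card_order \<theta>" "|B| <o \<theta>"
  obtains i where "i \<in> Field \<theta>" "|B| =o |underS \<theta> i|"
proof -
  have wo: "Well_order \<theta>"
    using assms(1) card_order_on_well_order_on by blast
  then obtain i where i: "i \<in> Field \<theta>" "|B| =o Restr \<theta> (underS \<theta> i)"
    using ordLess_iff_ordIso_Restr[OF wo card_of_Well_order[of B]] assms(2) by blast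
  have "Field (Restr \<theta> (underS \<theta> i)) = underS \<theta> i"
    by (intro Field_Restr_ofilter wo wo_rel.underS_ofilter) (simp add: wo_rel_def wo)
  with card_of_cong[OF i(2)] have "|B| =o |underS \<theta> i|"
    by (simp add: Field_card_of)
  with i that show thesis by blast
qed

lemma singleton_le_Cinfinite: "Cinfinite \<rho> \<Longrightarrow> |{x}| \<le>o \<rho>"
  by (intro ordLess_imp_ordLeq finite_card_less) auto

text \<open>The bound on powers quantifies over initial segments of \<open>\<theta>\<close> because
  an assumption cannot range over sets of all types; \<open>card_Func_le\<close> extends it to every
  set of size less than \<open>\<theta>\<close>.\<close>

locale closing_off_cardinals =
  fixes \<theta> :: "'l rel" and \<rho> :: "'r rel"
  assumes theta_infinite: "Cinfinite \<theta>" and theta_regular: "regularCard \<theta>"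
    and rho_infinite: "Cinfinite \<rho>"
    and rho_cexp: "\<And>i. i \<in> Field \<theta> \<Longrightarrow> \<rho> ^c |underS \<theta> i| \<le>o \<rho>"
begin

lemma theta_Card_order: "Card_order \<theta>" and rho_Card_order: "Card_order \<rho>"
  using theta_infinite rho_infinite by auto

lemma theta_Well_order: "Well_order \<theta>"
  using theta_Card_order card_order_on_well_order_on by blast

lemma card_Func_le: "|B| <o \<theta> \<Longrightarrow> |A| \<le>o \<rho> \<Longrightarrow> |Func B A| \<le>o \<rho>"
proof -
  assume B: "|B| <o \<theta>" and A: "|A| \<le>o \<rho>"
  obtain i where i: "i \<in> Field \<theta>" "|B| =o |underS \<theta> i|"
    using card_less_underS[OF theta_Card_order B] .
  have "|A| ^c |B| \<le>o \<rho> ^c |B|"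
    by (rule cexp_mono1[OF A card_of_Card_order])
  also have "\<rho> ^c |B| =o \<rho> ^c |underS \<theta> i|"
    by (rule cexp_cong2[OF i(2) rho_Card_order card_of_Card_order])
  also note rho_cexp[OF i(1)]
  finally show ?thesis
    by (simp add: cexp_def Field_card_of)
qed

text \<open>Otherwise \<open>\<rho>\<close> itself is an admissible exponent, and
  \<open>2^\<rho> \<le> \<rho>^\<rho> \<le> \<rho>\<close> contradicts Cantor's theorem.\<close>

lemma theta_le_rho: "\<theta> \<le>o \<rho>"
proof (rule ccontr)
  assume "\<not> \<theta> \<le>o \<rho>"
  then have "\<rho> <o \<theta>"
    using theta_Well_order rho_Card_order card_order_on_well_order_on not_ordLeq_iff_ordLess by blast
  then have "|Field \<rho>| <o \<theta>"
    by (rule ordLess_Field)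
  moreover have "|Field \<rho>| \<le>o \<rho>"
    using card_of_Field_ordIso[OF rho_Card_order] ordIso_imp_ordLeq by blast
  ultimately have "\<rho> ^c \<rho> \<le>o \<rho>"
    using card_Func_le by (simp add: cexp_def)
  moreover have "ctwo ^c \<rho> \<le>o \<rho> ^c \<rho>"
    by (intro cexp_mono1 ctwo_ordLeq_Cinfinite rho_infinite rho_Card_order)
  ultimately have "ctwo ^c \<rho> \<le>o \<rho>"
    by (metis ordLeq_transitive)
  moreover have "\<rho> <o ctwo ^c \<rho>"
    by (rule ordLess_ctwo_cexp[OF rho_Card_order])
  ultimately show False
    using not_ordLess_ordLeq by blast
qed

lemma less_le_rho: "|A| <o \<theta> \<Longrightarrow> |A| \<le>o \<rho>"
  by (metis theta_le_rho ordLess_imp_ordLeq ordLeq_transitive)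

lemma image_le_rho: "|A| \<le>o \<rho> \<Longrightarrow> |f ` A| \<le>o \<rho>"
  using ordLeq_transitive[OF card_of_image] .

lemma subset_le_rho: "|A| \<le>o \<rho> \<Longrightarrow> B \<subseteq> A \<Longrightarrow> |B| \<le>o \<rho>"
  using ordLeq_transitive[OF card_of_mono1] .

lemma UN_le_rho: "|I| \<le>o \<rho> \<Longrightarrow> (\<And>i. i \<in> I \<Longrightarrow> |A i| \<le>o \<rho>) \<Longrightarrow> |\<Union>i\<in>I. A i| \<le>o \<rho>"
  using UNION_Cinfinite_bound rho_infinite by blast

text \<open>A nonempty small subset of \<open>A\<close> is the image of a map from an initial
  segment of \<open>\<theta>\<close> to \<open>A\<close>. There are at most
  \<open>\<theta> \<le> \<rho>\<close> segments and at most \<open>\<rho>\<close> maps on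
  each.\<close>

lemma card_Pow_less:
  assumes A: "|A| \<le>o \<rho>"
  shows "|Pow_less \<theta> A| \<le>o \<rho>"
proof -
  let ?I = "\<lambda>i. (\<lambda>g. g ` underS \<theta> i) ` Func (underS \<theta> i) A"
  have "Pow_less \<theta> A \<subseteq> {{}} \<union> (\<Union>i\<in>Field \<theta>. ?I i)"
  proof
    fix B assume "B \<in> Pow_less \<theta> A"
    then have B: "B \<subseteq> A" "|B| <o \<theta>"
      by (auto simp: Pow_less_def)
    obtain i where i: "i \<in> Field \<theta>" "|B| =o |underS \<theta> i|"
      using card_less_underS[OF theta_Card_order B(2)] .
    show "B \<in> {{}} \<union> (\<Union>i\<in>Field \<theta>. ?I i)"
    proof (cases "B = {}")
      case False
      then obtain f where f: "f ` underS \<theta> i = B"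
        using card_of_ordLeq2[of B "underS \<theta> i"] ordIso_imp_ordLeq[OF i(2)] by blast
      \<comment> \<open>\<open>Func\<close> prescribes the value \<open>undefined\<close> outside
        the domain.\<close>
      define g where "g = (\<lambda>x. if x \<in> underS \<theta> i then f x else undefined)"
      have "g \<in> Func (underS \<theta> i) A" "g ` underS \<theta> i = B"
        using f B(1) by (auto simp: Func_def g_def)
      then show ?thesis
        using i(1) by blast
    qed simp
  qed
  moreover have "|\<Union>i\<in>Field \<theta>. ?I i| \<le>o \<rho>"
  proof (rule UN_le_rho)
    show "|Field \<theta>| \<le>o \<rho>"
      using ordIso_ordLeq_trans[OF card_of_Field_ordIso[OF theta_Card_order] theta_le_rho] .
    show "|?I i| \<le>o \<rho>" if "i \<in> Field \<theta>" for i
      by (intro image_le_rho card_Func_le A card_of_underS theta_Card_order that)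
  qed
  moreover have "|{{}::'b set}| \<le>o \<rho>"
    by (rule singleton_le_Cinfinite[OF rho_infinite])
  ultimately show ?thesis
    by (meson Un_Cinfinite_bound rho_infinite subset_le_rho)
qed

text \<open>A recursion of length \<open>\<theta>\<close> applies \<open>\<Psi>\<close> at each
  stage to all small subsets of the union of the earlier stages; by \<open>card_Pow_less\<close>
  every stage has size at most \<open>\<rho>\<close>. As \<open>\<theta>\<close> is regular, a small
  subset of the union of all stages lies in a single stage.\<close>

lemma closing_off:
  fixes \<Psi> :: "'a set \<Rightarrow> 'a set"
  assumes \<Psi>: "\<And>B. |B| <o \<theta> \<Longrightarrow> |\<Psi> B| \<le>o \<rho>"
  obtains Y where "|Y| \<le>o \<rho>" "\<forall>B\<in>Pow_less \<theta> Y. \<Psi> B \<subseteq> Y"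
proof -
  have wf: "wf (\<theta> - Id)"
    using theta_Well_order by (simp add: well_order_on_def)
  define F where "F = (\<lambda>f i. \<Union>B\<in>Pow_less \<theta> (\<Union>j\<in>underS \<theta> i. f j). \<Psi> B)"
  define y where "y = wfrec (\<theta> - Id) F"
  have y: "y i = F y i" for i
  proof -
    have "y i = F (cut y (\<theta> - Id) i) i"
      unfolding y_def by (rule wfrec[OF wf])
    also have "\<dots> = F y i"
    proof -
      have "(\<Union>j\<in>underS \<theta> i. cut y (\<theta> - Id) i j) = (\<Union>j\<in>underS \<theta> i. y j)"
        by (rule SUP_cong) (auto simp: underS_def cut_apply)
      then show ?thesis
        by (simp add: F_def)
    qed
    finally show ?thesis .
  qed
  have chain: "relChain \<theta> y"
    unfolding relChain_def
  proof (intro allI impI)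
    fix i j assume ij: "(i, j) \<in> \<theta>"
    have "underS \<theta> i \<subseteq> underS \<theta> j"
      using underS_incr[of \<theta> i j] theta_Well_order ij
      by (auto simp: order_on_defs)
    then show "y i \<subseteq> y j"
      unfolding y[of i] y[of j] F_def by (intro UN_mono Pow_less_mono) auto
  qed
  have card_y: "|y i| \<le>o \<rho>" for i
    using wf
  proof (induction i rule: wf_induct_rule)
    case (less i)
    have "|underS \<theta> i| \<le>o \<rho>"
    proof (cases "i \<in> Field \<theta>")
      case True
      then show ?thesis by (intro less_le_rho card_of_underS theta_Card_order)
    next
      case False
      then show ?thesis
        by (simp add: underS_empty Card_order_empty rho_Card_order)
    qed
    then have "|\<Union>j\<in>underS \<theta> i. y j| \<le>o \<rho>"
      by (rule UN_le_rho) (auto intro: less simp: underS_def)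
    then have "|F y i| \<le>o \<rho>"
      unfolding F_def by (intro UN_le_rho[OF card_Pow_less]) (auto simp: Pow_less_def intro: \<Psi>)
    then show ?case
      by (simp add: y[symmetric])
  qed
  define Y where "Y = (\<Union>i\<in>Field \<theta>. y i)"
  show thesis
  proof
    show "|Y| \<le>o \<rho>"
      unfolding Y_def
      using ordIso_ordLeq_trans[OF card_of_Field_ordIso[OF theta_Card_order] theta_le_rho] card_y
      by (rule UN_le_rho)
    show "\<forall>B\<in>Pow_less \<theta> Y. \<Psi> B \<subseteq> Y"
    proof
      fix B assume "B \<in> Pow_less \<theta> Y"
      then have B: "B \<subseteq> Y" "|B| <o \<theta>"
        by (auto simp: Pow_less_def)
      then obtain i where i: "i \<in> Field \<theta>" "B \<subseteq> y i"
        using regularCard_UNION[OF theta_Card_order theta_regular chain] unfolding Y_def by blast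
      \<comment> \<open>\<open>\<Psi> B\<close> is only sure to enter at a stage strictly after
        \<open>i\<close>; an infinite cardinal has no last element, so there is one.\<close>
      obtain j where j: "j \<in> Field \<theta>" "i \<noteq> j" "(i, j) \<in> \<theta>"
        using infinite_Card_order_limit[OF theta_Card_order _ i(1)] theta_infinite
        by (auto simp: cinfinite_def)
      have "B \<in> Pow_less \<theta> (\<Union>k\<in>underS \<theta> j. y k)"
        using B i j by (auto simp: Pow_less_def underS_def)
      then have "\<Psi> B \<subseteq> y j"
        unfolding y[of j] F_def by blast
      with j(1) show "\<Psi> B \<subseteq> Y"
        by (auto simp: Y_def)
    qed
  qed
qed

end

section \<open>Free sets\<close>

text \<open>\<open>free_in\<close> asks for a well-order of the set itself instead of an indexing.
  The order carried over by the injective \<open>f\<close> serves, since its initial and final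
  segments are the images of those of \<open>r\<close>.\<close>

lemma free_in_image:
  assumes fs: "free_sequence X r f" and inj: "inj_on f (Field r)"
  shows "free_in X (f ` Field r)"
proof -
  let ?d = "dir_image r f"
  have wo: "Well_order ?d"
    using fs inj by (intro Well_order_dir_image) (auto simp: free_sequence_def)
  have field: "Field ?d = f ` Field r"
    by (rule dir_image_Field)
  have mem: "(x, f b) \<in> ?d \<longleftrightarrow> (\<exists>a. x = f a \<and> (a, b) \<in> r)"
    and mem': "(f b, x) \<in> ?d \<longleftrightarrow> (\<exists>a. x = f a \<and> (b, a) \<in> r)" if "b \<in> Field r" for b x
    using that inj_onD[OF inj] by (auto simp: dir_image_def) (metis FieldI1 FieldI2)+
  have under: "underS ?d (f b) = f ` underS r b" if "b \<in> Field r" for b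
    using mem[OF that] inj_onD[OF inj] that by (auto simp: underS_def) (metis FieldI1)
  have above: "above ?d (f b) = f ` above r b" if "b \<in> Field r" for b
    using mem'[OF that] by (auto simp: above_def)
  have disj: "X closure_of underS ?d b \<inter> X closure_of above ?d b = {}" if b: "b \<in> f ` Field r" for b
  proof -
    obtain a where a: "a \<in> Field r" "b = f a"
      using b by blast
    then have "X closure_of f ` underS r a \<inter> X closure_of f ` above r a = {}"
      using fs unfolding free_sequence_def by blast
    then show ?thesis
      by (simp add: a(2) under[OF a(1)] above[OF a(1)])
  qed
  have "free_sequence X ?d (\<lambda>s. s)"
    using fs wo disj unfolding free_sequence_def field by simp
  moreover have "f ` Field r \<subseteq> topspace X"
    using fs by (simp add: free_sequence_def)
  ultimately show ?thesis
    unfolding free_in_def using wo[unfolded field] by blast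
qed

text \<open>Finite sets are closed, so for any well-order of \<open>S\<close> the two closures are
  disjoint segments.\<close>

lemma free_in_finite:
  assumes "t1_space X" "finite S" "S \<subseteq> topspace X"
  shows "free_in X S"
proof -
  obtain r where r: "well_order_on S r"
    using well_order_on by blast
  then have f: "Field r = S" and wo: "Well_order r"
    using well_order_on_Well_order by blast+
  have cl: "X closure_of T = T" if "T \<subseteq> S" for T
    using that assms by (intro closure_of_closedin t1_space_closedin_finite[THEN iffD1, rule_format])
      (auto intro: finite_subset)
  have "X closure_of underS r b \<inter> X closure_of above r b = {}" if "b \<in> S" for b
  proof -
    have "underS r b \<subseteq> S" "above r b \<subseteq> S"
      using f by (auto simp: underS_def above_def Field_def)
    moreover have "underS r b \<inter> above r b = {}"
      using wo by (auto simp: underS_def above_def order_on_defs antisym_def)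
    ultimately show ?thesis
      by (simp add: cl)
  qed
  then show ?thesis
    using r wo f assms(3) unfolding free_in_def free_sequence_def by auto
qed

text \<open>The open set \<open>W i\<close> separates the two halves at \<open>i\<close>: it
  contains the closure of the earlier terms, and the terms from \<open>i\<close> on lie in its
  closed complement. Injectivity follows, since for \<open>i\<close> below \<open>j\<close> the set
  \<open>W j\<close> contains \<open>f i\<close> but not \<open>f j\<close>. An arbitrary initial
  segment \<open>J\<close> is allowed so that freeness can be proved by induction on the
  length.\<close>

lemma free_in_ofilter:
  assumes wo: "Well_order r" and J: "wo_rel.ofilter r J" and sub: "f ` J \<subseteq> topspace X"
    and W: "\<And>i. i \<in> J \<Longrightarrow> openin X (W i)" "\<And>i. i \<in> J \<Longrightarrow> X closure_of (f ` underS r i) \<subseteq> W i"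
    and avoid: "\<And>i j. j \<in> J \<Longrightarrow> (i, j) \<in> r \<Longrightarrow> f j \<notin> W i"
  shows "free_in X (f ` J)" "inj_on f J"
proof -
  let ?r = "Restr r J"
  have wr: "wo_rel r" by (simp add: wo_rel_def wo)
  have field: "Field ?r = J"
    by (rule Field_Restr_ofilter[OF wo J])
  have down: "i \<in> J" if "j \<in> J" "(i, j) \<in> r" for i j
    using J that by (auto simp: wo_rel.ofilter_def[OF wr] under_def)
  have JF: "J \<subseteq> Field r"
    using J by (simp add: wo_rel.ofilter_def[OF wr])
  have less: "f i \<noteq> f j" if "j \<in> J" "i \<in> underS r j" for i j
  proof -
    have "i \<in> J"
      using that down by (auto simp: underS_def)
    have "f ` underS r j \<subseteq> X closure_of (f ` underS r j)"
      using that(1) sub down by (intro closure_of_subset) (auto simp: underS_def)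
    then have "f i \<in> W j"
      using W(2)[OF that(1)] that(2) by blast
    moreover have "f j \<notin> W j"
      using that(1) JF wo_rel.REFL[OF wr] by (intro avoid) (auto simp: refl_on_def)
    ultimately show ?thesis
      by auto
  qed
  show inj: "inj_on f J"
  proof (rule inj_onI, rule ccontr)
    fix i j assume "i \<in> J" "j \<in> J" "f i = f j" "i \<noteq> j"
    moreover from this have "(i, j) \<in> r \<or> (j, i) \<in> r"
      using JF wo_rel.TOTALS[OF wr] by blast
    ultimately show False
      using less[of j i] less[of i j] unfolding underS_def by fastforce
  qed
  have "X closure_of (f ` underS ?r i) \<inter> X closure_of (f ` above ?r i) = {}" if i: "i \<in> J" for i
  proof -
    have "f ` above ?r i \<subseteq> topspace X - W i"
      using avoid sub by (auto simp: above_def)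
    then have "X closure_of (f ` above ?r i) \<subseteq> topspace X - W i"
      using W(1)[OF i] by (intro closure_of_minimal) auto
    moreover have "underS ?r i \<subseteq> underS r i"
      by (auto simp: underS_def)
    then have "X closure_of (f ` underS ?r i) \<subseteq> W i"
      using W(2)[OF i] closure_of_mono[of "f ` underS ?r i" "f ` underS r i"] by blast
    ultimately show ?thesis
      by blast
  qed
  then have "free_sequence X ?r f"
    using sub Well_order_Restr[OF wo, of J] by (simp add: free_sequence_def field)
  from free_in_image[OF this] inj show "free_in X (f ` J)"
    by (simp add: field)
qed

section \<open>Small covers by intersections of open sets\<close>

context closing_off_cardinals
begin

lemma UN_less:
  "|I| <o \<theta> \<Longrightarrow> (\<And>i. i \<in> I \<Longrightarrow> |A i| <o \<theta>) \<Longrightarrow> |\<Union>i\<in>I. A i| <o \<theta>"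
  using card_of_UNION_ordLess_infinite_Field_regularCard[OF theta_regular theta_infinite] by blast

lemma Union_less:
  "|\<A>| <o \<theta> \<Longrightarrow> (\<And>A. A \<in> \<A> \<Longrightarrow> |A| <o \<theta>) \<Longrightarrow> |\<Union>\<A>| <o \<theta>"
  using UN_less[of \<A> "\<lambda>A. A"] by simp

lemma finite_less: "finite A \<Longrightarrow> |A| <o \<theta>"
  by (rule finite_card_less[OF theta_infinite])

lemma insert_less: "|A| <o \<theta> \<Longrightarrow> |insert a A| <o \<theta>"
  using Un_Cinfinite_bound_strict[OF finite_less[of "{a}"] _ theta_infinite] by simp

text \<open>Each term is chosen in \<open>Y\<close> outside the small families assigned to all
  earlier initial segments. The union of these families is small because \<open>\<theta>\<close> is
  regular, so \<open>avoid\<close> supplies a point. Induction then shows that the initial segments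
  are free, hence that the assigned families do cover their closures.\<close>

lemma long_free_sequence:
  assumes op: "\<And>V. V \<in> \<P> \<Longrightarrow> openin X V"
    and Y: "Y \<subseteq> topspace X"
    and cov: "\<And>S. free_in X S \<Longrightarrow> S \<subseteq> Y \<Longrightarrow> |S| <o \<theta> \<Longrightarrow>
      \<exists>\<W>\<in>Pow_less \<theta> \<P>. X closure_of S \<subseteq> \<Union>\<W>"
    and avoid: "\<And>\<W>. \<W> \<in> Pow_less \<theta> \<P> \<Longrightarrow> \<not> Y \<subseteq> \<Union>\<W>"
  obtains S where "free_in X S" "S \<subseteq> Y" "|S| =o \<theta>"
proof -
  \<comment> \<open>Choosing \<open>c S\<close> small for every \<open>S\<close>, free or not, lets the recursion below run without
    knowing that the initial segments built so far are free.\<close>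
  define c where "c = (\<lambda>S. SOME \<W>. \<W> \<in> Pow_less \<theta> \<P> \<and>
    ((\<exists>\<W>\<in>Pow_less \<theta> \<P>. X closure_of S \<subseteq> \<Union>\<W>) \<longrightarrow> X closure_of S \<subseteq> \<Union>\<W>))"
  have "\<exists>\<W>. \<W> \<in> Pow_less \<theta> \<P> \<and>
    ((\<exists>\<W>\<in>Pow_less \<theta> \<P>. X closure_of S \<subseteq> \<Union>\<W>) \<longrightarrow> X closure_of S \<subseteq> \<Union>\<W>)" for S
  proof -
    have "{} \<in> Pow_less \<theta> \<P>"
      by (simp add: Pow_less_def finite_less)
    then show ?thesis
      by blast
  qed
  from someI_ex[OF this]
  have c: "c S \<in> Pow_less \<theta> \<P>"
    "\<exists>\<W>\<in>Pow_less \<theta> \<P>. X closure_of S \<subseteq> \<Union>\<W> \<Longrightarrow> X closure_of S \<subseteq> \<Union>(c S)" for S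
    unfolding c_def by blast+
  have wo: "Well_order \<theta>" and wr: "wo_rel \<theta>"
    using theta_Well_order by (simp_all add: wo_rel_def)
  have wf: "wf (\<theta> - Id)"
    using wo by (simp add: well_order_on_def)
  have trans: "trans \<theta>"
    by (rule wo_rel.TRANS[OF wr])
  \<comment> \<open>The case \<open>i = j\<close> is included: it keeps \<open>f j\<close> away from
    the closure of its predecessors. For \<open>i\<close> up to \<open>j\<close> only values of
    \<open>f\<close> strictly below \<open>j\<close> occur, which makes this a legitimate
    recursion.\<close>
  define P where "P = (\<lambda>f j x. j \<in> Field \<theta> \<longrightarrow>
    x \<in> Y \<and> (\<forall>i. (i, j) \<in> \<theta> \<longrightarrow> x \<notin> \<Union>(c (f ` underS \<theta> i))))"
  have "\<exists>f. \<forall>j. P f j (f j)"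
  proof (rule dependent_wf_choice[OF wf])
    fix f g :: "'l \<Rightarrow> 'a" and j :: 'l and x
    assume eq: "\<And>z. (z, j) \<in> \<theta> - Id \<Longrightarrow> f z = g z"
    have "f ` underS \<theta> i = g ` underS \<theta> i" if "(i, j) \<in> \<theta>" for i
    proof (rule image_cong[OF refl])
      fix z assume "z \<in> underS \<theta> i"
      then have "z \<in> underS \<theta> j"
        using underS_incr[OF trans wo_rel.ANTISYM[OF wr] that] by blast
      then show "f z = g z"
        by (intro eq) (auto simp: underS_def)
    qed
    then show "P f j x = P g j x"
      by (simp add: P_def)
  next
    fix j and f :: "'l \<Rightarrow> 'a"
    show "\<exists>x. P f j x"
    proof (cases "j \<in> Field \<theta>")
      case True
      let ?W = "\<Union>i\<in>under \<theta> j. c (f ` underS \<theta> i)"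
      have "under \<theta> j = insert j (underS \<theta> j)"
        using Refl_under_underS[OF wo_rel.REFL[OF wr] True] by simp
      then have "|under \<theta> j| <o \<theta>"
        using insert_less card_of_underS[OF theta_Card_order True] by simp
      then have "|?W| <o \<theta>"
        by (rule UN_less) (use c(1) in \<open>simp add: Pow_less_def\<close>)
      moreover have "?W \<subseteq> \<P>"
        using c(1) by (auto simp: Pow_less_def)
      ultimately have "\<not> Y \<subseteq> \<Union>?W"
        by (intro avoid) (simp add: Pow_less_def)
      then show ?thesis
        by (auto simp: P_def under_def)
    qed (simp add: P_def)
  qed
  then obtain f where f: "\<And>j. P f j (f j)"
    by blast
  have fY: "f ` J \<subseteq> Y" if "J \<subseteq> Field \<theta>" for J
    using f that by (auto simp: P_def)
  have fin: "free_in X (f ` J) \<and> inj_on f J"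
    if J: "wo_rel.ofilter \<theta> J" and IH: "\<And>i. i \<in> J \<Longrightarrow> free_in X (f ` underS \<theta> i)" for J
  proof -
    have JF: "J \<subseteq> Field \<theta>"
      using J by (simp add: wo_rel.ofilter_def[OF wr])
    have 1: "openin X (\<Union>(c (f ` underS \<theta> i)))" for i
      using c(1)[of "f ` underS \<theta> i"] op by (auto simp: Pow_less_def)
    have 2: "X closure_of (f ` underS \<theta> i) \<subseteq> \<Union>(c (f ` underS \<theta> i))" if "i \<in> J" for i
    proof -
      have "i \<in> Field \<theta>"
        using that JF by blast
      then have "|f ` underS \<theta> i| <o \<theta>"
        by (intro card_of_image_less card_of_underS theta_Card_order)
      then show ?thesis
        by (intro c(2) cov IH[OF that] fY[OF Order_Relation.underS_Field])
    qed
    have 3: "f j \<notin> \<Union>(c (f ` underS \<theta> i))" if "j \<in> J" "(i, j) \<in> \<theta>" for i j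
      using f[of j] that JF unfolding P_def by blast
    have 4: "f ` J \<subseteq> topspace X"
      using fY[OF JF] Y by (rule subset_trans)
    show ?thesis
      using free_in_ofilter[OF wo J 4 1 2 3] by (rule conjI)
  qed
  have IH: "free_in X (f ` underS \<theta> i)" for i
    using wf
  proof (induction i rule: wf_induct_rule)
    case (less i)
    show ?case
      by (rule fin[OF wo_rel.underS_ofilter[OF wr], THEN conjunct1], rule less) (auto simp: underS_def)
  qed
  have free: "free_in X (f ` Field \<theta>)" and inj: "inj_on f (Field \<theta>)"
    using fin[OF wo_rel.Field_ofilter[OF wr] IH] by auto
  have "|Field \<theta>| =o |f ` Field \<theta>|"
    by (rule card_of_ordIsoI[OF inj_on_imp_bij_betw[OF inj]])
  then have "|f ` Field \<theta>| =o \<theta>"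
    by (rule ordIso_transitive[OF ordIso_symmetric card_of_Field_ordIso[OF theta_Card_order]])
  with free fY[OF subset_refl] show thesis
    by (rule that)
qed

text \<open>Fix \<open>G\<close> in \<open>\<O>\<close>. Points other than \<open>q\<close> can be
  separated from \<open>q\<close>, so \<open>G\<close> and the complements of the closures of the
  traces \<open>S \<inter> W\<close> cover the closure of \<open>S\<close>. A small subcover gives a
  small family of traces whose closures meet, within the closure of \<open>S\<close>, inside
  \<open>G\<close>. Collecting these families over the small \<open>\<O>\<close> keeps the total
  small.\<close>

lemma closure_trace_inside_G_less:
  assumes H: "Hausdorff_space X" and S: "S \<subseteq> topspace X" "|S| <o \<theta>"
    and lind: "\<And>\<U>. (\<And>U. U \<in> \<U> \<Longrightarrow> openin X U) \<Longrightarrow> X closure_of S \<subseteq> \<Union>\<U> \<Longrightarrow>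
      \<exists>\<V>\<in>Pow_less \<theta> \<U>. X closure_of S \<subseteq> \<Union>\<V>"
    and q: "q \<in> X closure_of S"
    and \<O>: "|\<O>| <o \<theta>" "\<And>G. G \<in> \<O> \<Longrightarrow> openin X G" "q \<in> \<Inter>\<O>"
  obtains \<T> where "\<T> \<in> Pow_less \<theta> (Pow_less \<theta> S)" "\<And>T. T \<in> \<T> \<Longrightarrow> q \<in> X closure_of T"
    "topspace X \<inter> \<Inter>((closure_of) X ` \<T>) \<subseteq> \<Inter>\<O>"
proof -
  define N where "N = {S \<inter> W | W. openin X W \<and> q \<in> W}"
  have qX: "q \<in> topspace X"
    using q by (meson in_closure_of)
  have N: "q \<in> X closure_of T" if T: "T \<in> N" for T
  proof -
    obtain W where W: "T = S \<inter> W" "openin X W" "q \<in> W"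
      using T by (auto simp: N_def)
    show ?thesis
      unfolding in_closure_of
    proof (intro conjI allI impI qX)
      fix V assume "q \<in> V \<and> openin X V"
      then have "openin X (W \<inter> V)" "q \<in> W \<inter> V"
        using W by auto
      then obtain y where "y \<in> S" "y \<in> W \<inter> V"
        using q unfolding in_closure_of by metis
      then show "\<exists>y. y \<in> T \<and> y \<in> V"
        using W(1) by blast
    qed
  qed
  have "\<exists>\<T>. \<T> \<subseteq> N \<and> |\<T>| <o \<theta> \<and> X closure_of S \<inter> \<Inter>((closure_of) X ` \<T>) \<subseteq> G"
    if G: "G \<in> \<O>" for G
  proof -
    let ?U = "\<lambda>T. topspace X - X closure_of T"
    have "X closure_of S \<subseteq> \<Union>(insert G (?U ` N))"
    proof
      fix z assume z: "z \<in> X closure_of S"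
      then have zX: "z \<in> topspace X"
        by (meson in_closure_of)
      show "z \<in> \<Union>(insert G (?U ` N))"
      proof (cases "z = q")
        case True
        then show ?thesis using \<O>(3) G by blast
      next
        case False
        then obtain V W where VW: "openin X V" "openin X W" "z \<in> V" "q \<in> W" "disjnt V W"
          using H zX qX unfolding Hausdorff_space_def by blast
        then have "z \<notin> X closure_of (S \<inter> W)"
          unfolding in_closure_of disjnt_def by blast
        moreover have "S \<inter> W \<in> N"
          using VW unfolding N_def by blast
        ultimately show ?thesis
          using zX by blast
      qed
    qed
    moreover have "openin X U" if "U \<in> insert G (?U ` N)" for U
      using that \<O>(2)[OF G] by auto
    ultimately obtain \<V> where \<V>: "\<V> \<in> Pow_less \<theta> (insert G (?U ` N))" "X closure_of S \<subseteq> \<Union>\<V>"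
      using lind by blast
    then have sub: "\<V> - {G} \<subseteq> ?U ` N"
      by (auto simp: Pow_less_def)
    have card: "|\<V> - {G}| <o \<theta>"
      using \<V>(1) by (intro card_of_subset_less[of \<V> \<theta>, OF _ Diff_subset]) (simp add: Pow_less_def)
    from sub have "\<forall>V\<in>\<V> - {G}. \<exists>T. T \<in> N \<and> V = ?U T"
      by blast
    from bchoice[OF this] obtain g where g: "\<And>V. V \<in> \<V> - {G} \<Longrightarrow> g V \<in> N \<and> V = ?U (g V)"
      by blast
    show ?thesis
    proof (intro exI[of _ "g ` (\<V> - {G})"] conjI)
      show "g ` (\<V> - {G}) \<subseteq> N"
        using g by blast
      show "|g ` (\<V> - {G})| <o \<theta>"
        by (rule card_of_image_less[OF card])
      show "X closure_of S \<inter> \<Inter>((closure_of) X ` g ` (\<V> - {G})) \<subseteq> G"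
      proof
        fix z assume z: "z \<in> X closure_of S \<inter> \<Inter>((closure_of) X ` g ` (\<V> - {G}))"
        then obtain V where "V \<in> \<V>" "z \<in> V"
          using \<V>(2) by blast
        \<comment> \<open>A member \<open>V\<close> other than \<open>G\<close> is the complement of
          the closure of \<open>g V\<close>, which contains \<open>z\<close>; hence
          \<open>V = G\<close>.\<close>
        then show "z \<in> G"
          using z g[of V] by (cases "V = G") auto
      qed
    qed
  qed
  then have "\<forall>G\<in>\<O>. \<exists>\<T>. \<T> \<subseteq> N \<and> |\<T>| <o \<theta> \<and> X closure_of S \<inter> \<Inter>((closure_of) X ` \<T>) \<subseteq> G"
    by (rule ballI)
  from bchoice[OF this] obtain t where "\<forall>G\<in>\<O>. t G \<subseteq> N \<and> |t G| <o \<theta> \<and>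
      X closure_of S \<inter> \<Inter>((closure_of) X ` t G) \<subseteq> G"
    by (rule exE)
  note t = bspec[OF this]
  \<comment> \<open>\<open>S\<close> is added because each \<open>t G\<close> controls the
    intersection only inside the closure of \<open>S\<close>.\<close>
  let ?T = "insert S (\<Union>G\<in>\<O>. t G)"
  have NS: "N \<subseteq> Pow_less \<theta> S"
    by (auto simp: N_def Pow_less_def intro: card_of_subset_less[OF S(2)])
  show thesis
  proof
    have "|?T| <o \<theta>"
      using t by (intro insert_less UN_less \<O>(1)) blast
    moreover have "?T \<subseteq> Pow_less \<theta> S"
    proof -
      have "S \<in> Pow_less \<theta> S"
        using S by (simp add: Pow_less_def)
      moreover have "(\<Union>G\<in>\<O>. t G) \<subseteq> N"
        using t by blast
      ultimately show ?thesis
        using NS by blast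
    qed
    ultimately show "?T \<in> Pow_less \<theta> (Pow_less \<theta> S)"
      by (simp add: Pow_less_def)
    show "q \<in> X closure_of T" if "T \<in> ?T" for T
    proof -
      have "T = S \<or> T \<in> N"
        using that t by blast
      then show ?thesis
        using q N by blast
    qed
    show "topspace X \<inter> \<Inter>((closure_of) X ` ?T) \<subseteq> \<Inter>\<O>"
    proof (rule Inter_greatest)
      fix G assume G: "G \<in> \<O>"
      then have "topspace X \<inter> \<Inter>((closure_of) X ` ?T) \<subseteq> X closure_of S \<inter> \<Inter>((closure_of) X ` t G)"
        by blast
      also have "\<dots> \<subseteq> G"
        using t[OF G] by blast
      finally show "topspace X \<inter> \<Inter>((closure_of) X ` ?T) \<subseteq> G" .
    qed
  qed
qed

text \<open>A member of the cover is represented by a small family of open sets with that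
  intersection, so that its defining open sets remain available to the closing-off.\<close>

lemma Lindelof_G_less:
  assumes H: "Hausdorff_space X"
    and free: "\<And>S. free_in X S \<Longrightarrow> |S| <o \<theta>"
    and lind: "\<And>S \<U>. free_in X S \<Longrightarrow> (\<And>U. U \<in> \<U> \<Longrightarrow> openin X U) \<Longrightarrow> X closure_of S \<subseteq> \<Union>\<U> \<Longrightarrow>
      \<exists>\<V>\<in>Pow_less \<theta> \<U>. X closure_of S \<subseteq> \<Union>\<V>"
    and \<C>: "\<And>\<O>. \<O> \<in> \<C> \<Longrightarrow> |\<O>| <o \<theta>" "\<And>\<O> G. \<O> \<in> \<C> \<Longrightarrow> G \<in> \<O> \<Longrightarrow> openin X G"
    and cover: "topspace X \<subseteq> (\<Union>\<O>\<in>\<C>. \<Inter>\<O>)"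
  obtains \<D> where "\<D> \<subseteq> \<C>" "|\<D>| \<le>o \<rho>" "topspace X \<subseteq> (\<Union>\<O>\<in>\<D>. \<Inter>\<O>)"
proof -
  define K where "K = (\<lambda>\<T>. topspace X \<inter> \<Inter>((closure_of) X ` \<T>))"
  \<comment> \<open>The choice depends on \<open>\<T>\<close> alone, so \<open>D B\<close> has no
    more members than there are small families of small subsets of \<open>B\<close>.\<close>
  define g where "g = (\<lambda>\<T>. SOME \<O>. \<O> \<in> \<C> \<and> K \<T> \<subseteq> \<Inter>\<O>)"
  have g: "g \<T> \<in> \<C>" "K \<T> \<subseteq> \<Inter>(g \<T>)" if "\<exists>\<O>\<in>\<C>. K \<T> \<subseteq> \<Inter>\<O>" for \<T>
    using someI_ex[of "\<lambda>\<O>. \<O> \<in> \<C> \<and> K \<T> \<subseteq> \<Inter>\<O>"] that unfolding g_def by blast+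
  define D where "D = (\<lambda>B. g ` {\<T> \<in> Pow_less \<theta> (Pow_less \<theta> B). \<exists>\<O>\<in>\<C>. K \<T> \<subseteq> \<Inter>\<O>})"
  have DC: "D B \<subseteq> \<C>" for B
    using g by (auto simp: D_def)
  have card_D: "|D B| \<le>o \<rho>" if "|B| \<le>o \<rho>" for B
    unfolding D_def by (rule image_le_rho, rule subset_le_rho[OF card_Pow_less[OF card_Pow_less[OF that]]]) auto
  define h where "h = (\<lambda>\<W>. SOME x. x \<in> topspace X - \<Union>\<W>)"
  have h: "h \<W> \<in> topspace X - \<Union>\<W>" if "\<not> topspace X \<subseteq> \<Union>\<W>" for \<W>
    using someI_ex[of "\<lambda>x. x \<in> topspace X - \<Union>\<W>"] that unfolding h_def by blast
  \<comment> \<open>For every small family of defining sets obtained from \<open>B\<close> that does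
    not cover the space, this contains a point outside its union.\<close>
  define \<Psi> where "\<Psi> = (\<lambda>B. h ` Pow_less \<theta> (\<Union>(D B)))"
  have card_\<Psi>: "|\<Psi> B| \<le>o \<rho>" if "|B| <o \<theta>" for B
  proof -
    have "|\<Union>\<O>\<in>D B. \<O>| \<le>o \<rho>"
      using DC \<C>(1) by (intro UN_le_rho card_D less_le_rho that) blast
    then show ?thesis
      unfolding \<Psi>_def by (intro image_le_rho card_Pow_less) simp
  qed
  obtain Y where Y: "|Y| \<le>o \<rho>" "\<forall>B\<in>Pow_less \<theta> Y. \<Psi> B \<subseteq> Y"
    by (rule closing_off[of \<Psi>, OF card_\<Psi>]) (assumption, rule that)
  show thesis
  proof
    show "D Y \<subseteq> \<C>" "|D Y| \<le>o \<rho>"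
      by (rule DC, rule card_D[OF Y(1)])
    show "topspace X \<subseteq> (\<Union>\<O>\<in>D Y. \<Inter>\<O>)"
    proof (rule ccontr)
      assume "\<not> topspace X \<subseteq> (\<Union>\<O>\<in>D Y. \<Inter>\<O>)"
      then obtain p where p: "p \<in> topspace X" "\<And>\<O>. \<O> \<in> D Y \<Longrightarrow> p \<notin> \<Inter>\<O>"
        by blast
      \<comment> \<open>Each member of \<open>D Y\<close> contributes a set to \<open>\<P>\<close>,
        since \<open>p\<close> is outside its intersection; and no subfamily of \<open>\<P>\<close>
        covers \<open>p\<close>.\<close>
      define \<P> where "\<P> = {V \<in> \<Union>(D Y). p \<notin> V}"
      have open_P: "openin X V" if "V \<in> \<P>" for V
        using that DC \<C>(2) unfolding \<P>_def by blast
      have closure_P: "X closure_of S \<subseteq> \<Union>\<P>" if S: "free_in X S" "S \<subseteq> Y" for S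
      proof
        fix q assume q: "q \<in> X closure_of S"
        have SX: "S \<subseteq> topspace X" and qX: "q \<in> topspace X"
          using S(1) q by (auto simp: free_in_def in_closure_of)
        obtain \<O> where \<O>: "\<O> \<in> \<C>" "q \<in> \<Inter>\<O>"
          using qX cover by blast
        obtain \<T> where \<T>: "\<T> \<in> Pow_less \<theta> (Pow_less \<theta> S)"
          "\<And>T. T \<in> \<T> \<Longrightarrow> q \<in> X closure_of T" "K \<T> \<subseteq> \<Inter>\<O>"
          using closure_trace_inside_G_less[OF H SX free[OF S(1)] lind[OF S(1)] q \<C>(1)[OF \<O>(1)]
              \<C>(2)[OF \<O>(1)] \<O>(2)] unfolding K_def by blast
        have ex: "\<exists>\<O>\<in>\<C>. K \<T> \<subseteq> \<Inter>\<O>"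
          using \<T>(3) \<O>(1) by blast
        have "\<T> \<in> Pow_less \<theta> (Pow_less \<theta> Y)"
          using \<T>(1) Pow_less_mono[OF Pow_less_mono[OF S(2)]] by blast
        with ex have "g \<T> \<in> D Y"
          by (auto simp: D_def)
        moreover from this obtain V where "V \<in> g \<T>" "p \<notin> V"
          using p(2) by blast
        moreover have "q \<in> \<Inter>(g \<T>)"
          using g(2)[OF ex] \<T>(2) qX by (auto simp: K_def)
        ultimately show "q \<in> \<Union>\<P>"
          by (auto simp: \<P>_def)
      qed
      \<comment> \<open>A small \<open>\<W>\<close> already arises from a small
        \<open>B \<subseteq> Y\<close>, so the closing-off put a point outside its union into
        \<open>Y\<close>. The intersection with \<open>topspace X\<close> discards the arbitrary
        values that \<open>h\<close> takes on families covering the space.\<close>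
      have avoid: "\<not> topspace X \<inter> Y \<subseteq> \<Union>\<W>" if "\<W> \<in> Pow_less \<theta> \<P>" for \<W>
      proof -
        have \<W>: "\<W> \<subseteq> \<P>" "|\<W>| <o \<theta>"
          using that by (auto simp: Pow_less_def)
        have "\<forall>W\<in>\<W>. \<exists>\<T>. \<T> \<in> Pow_less \<theta> (Pow_less \<theta> Y) \<and> (\<exists>\<O>\<in>\<C>. K \<T> \<subseteq> \<Inter>\<O>) \<and> W \<in> g \<T>"
          using \<W>(1) unfolding \<P>_def D_def by blast
        then obtain t where t: "\<And>W. W \<in> \<W> \<Longrightarrow> t W \<in> Pow_less \<theta> (Pow_less \<theta> Y)"
          "\<And>W. W \<in> \<W> \<Longrightarrow> \<exists>\<O>\<in>\<C>. K (t W) \<subseteq> \<Inter>\<O>" "\<And>W. W \<in> \<W> \<Longrightarrow> W \<in> g (t W)"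
          by metis
        \<comment> \<open>All points occurring in the families \<open>t W\<close>: small, as two
          successive small unions of small sets are small.\<close>
        define B where "B = (\<Union>W\<in>\<W>. \<Union>(t W))"
        have "|B| <o \<theta>"
          unfolding B_def using t(1) by (intro UN_less Union_less \<W>(2)) (auto simp: Pow_less_def)
        moreover have "B \<subseteq> Y"
          unfolding B_def using t(1) by (force simp: Pow_less_def)
        ultimately have "\<Psi> B \<subseteq> Y"
          using Y(2) by (auto simp: Pow_less_def)
        have tB: "t W \<in> Pow_less \<theta> (Pow_less \<theta> B)" if "W \<in> \<W>" for W
          using t(1)[OF that] that unfolding Pow_less_def B_def by blast
        have "\<W> \<subseteq> \<Union>(D B)"
        proof
          fix W assume W: "W \<in> \<W>"
          have "g (t W) \<in> D B"
            unfolding D_def using tB[OF W] t(2)[OF W] by (intro imageI) simp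
          with t(3)[OF W] show "W \<in> \<Union>(D B)"
            by blast
        qed
        then have "h \<W> \<in> Y"
          using \<open>\<Psi> B \<subseteq> Y\<close> \<W>(2) unfolding \<Psi>_def Pow_less_def by blast
        moreover have "\<not> topspace X \<subseteq> \<Union>\<W>"
          using p(1) \<W>(1) by (auto simp: \<P>_def)
        from h[OF this] have "h \<W> \<in> topspace X - \<Union>\<W>" .
        ultimately show ?thesis
          by blast
      qed
      obtain S where "free_in X S" "|S| =o \<theta>"
      proof (rule long_free_sequence[of \<P> X "topspace X \<inter> Y"])
        show "\<exists>\<W>\<in>Pow_less \<theta> \<P>. X closure_of S \<subseteq> \<Union>\<W>"
          if "free_in X S" "S \<subseteq> topspace X \<inter> Y" for S
          using that closure_P by (intro lind open_P) auto
      qed (auto simp: open_P avoid)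
      then show False
        using free not_ordLess_ordIso by blast
    qed
  qed
qed

end

section \<open>The cardinals of the theorem\<close>

lemma cexp_le_of_less:
  fixes \<kappa> :: "'k rel" and \<rho> :: "'r rel"
  assumes "Card_order \<kappa>" "Card_order \<rho>"
    and pow: "\<And>\<nu> :: 'k rel. Card_order \<nu> \<Longrightarrow> \<nu> <o \<kappa> \<Longrightarrow> \<rho> ^c \<nu> \<le>o \<rho>"
    and B: "|B| <o \<kappa>"
  shows "\<rho> ^c |B| \<le>o \<rho>"
proof -
  obtain i where i: "i \<in> Field \<kappa>" "|B| =o |underS \<kappa> i|"
    using card_less_underS[OF assms(1) B] .
  have "\<rho> ^c |B| =o \<rho> ^c |underS \<kappa> i|"
    by (rule cexp_cong2[OF i(2) assms(2) card_of_Card_order])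
  also have "\<rho> ^c |underS \<kappa> i| \<le>o \<rho>"
    by (rule pow[OF card_of_Card_order card_of_underS[OF assms(1) i(1)]])
  finally show ?thesis .
qed

text \<open>Let \<open>K\<close> be cofinal with fewer than \<open>\<kappa>\<close> elements. A
  function on \<open>\<kappa>\<close> is determined by its restrictions to the segments below the
  members of \<open>K\<close>. Each segment admits at most \<open>\<rho>\<close> restrictions, so
  there are at most \<open>\<rho>\<close> in all, and
  \<open>\<rho>^\<kappa> \<le> \<rho>^|K| \<le> \<rho>\<close>.\<close>

lemma cexp_singular_le:
  fixes \<kappa> :: "'k rel" and \<rho> :: "'r rel"
  assumes \<kappa>: "Card_order \<kappa>" "\<not> regularCard \<kappa>" and \<rho>: "Cinfinite \<rho>"
    and pow: "\<And>B :: 'k set. |B| <o \<kappa> \<Longrightarrow> \<rho> ^c |B| \<le>o \<rho>"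
  shows "\<rho> ^c \<kappa> \<le>o \<rho>"
proof -
  obtain K where K: "K \<subseteq> Field \<kappa>" "cofinal K \<kappa>" "\<not> |K| =o \<kappa>"
    using \<kappa>(2) unfolding regularCard_def by blast
  have "|K| \<le>o \<kappa>"
    using ordLeq_ordIso_trans[OF card_of_mono1[OF K(1)] card_of_Field_ordIso[OF \<kappa>(1)]] .
  with K(3) have K_less: "|K| <o \<kappa>"
    using ordLeq_iff_ordLess_or_ordIso by blast
  let ?R = "\<Union>k\<in>K. Func (underS \<kappa> k) (Field \<rho>)"
  have "|K| \<le>o \<rho> ^c |K|"
    using \<rho> by (intro ordLeq_cexp2 ctwo_ordLeq_Cinfinite card_of_Card_order)
  then have "|K| \<le>o \<rho>"
    using pow[OF K_less] by (rule ordLeq_transitive)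
  moreover have "|Func (underS \<kappa> k) (Field \<rho>)| \<le>o \<rho>" if "k \<in> K" for k
  proof -
    have "|underS \<kappa> k| <o \<kappa>"
      using that K(1) by (intro card_of_underS \<kappa>(1)) auto
    from pow[OF this] show ?thesis
      by (simp add: cexp_def Field_card_of)
  qed
  ultimately have R: "|?R| \<le>o \<rho>"
    by (intro UNION_Cinfinite_bound ballI \<rho>)
  let ?\<phi> = "\<lambda>f k. if k \<in> K then (\<lambda>x. if x \<in> underS \<kappa> k then f x else undefined) else undefined"
  have "|Func (Field \<kappa>) (Field \<rho>)| \<le>o |Func K ?R|"
  proof (rule card_of_ordLeqI)
    show "inj_on ?\<phi> (Func (Field \<kappa>) (Field \<rho>))"
    proof (rule inj_onI, rule ext)
      fix f g x
      assume f: "f \<in> Func (Field \<kappa>) (Field \<rho>)" and g: "g \<in> Func (Field \<kappa>) (Field \<rho>)"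
        and eq: "?\<phi> f = ?\<phi> g"
      show "f x = g x"
      proof (cases "x \<in> Field \<kappa>")
        case True
        \<comment> \<open>\<open>cofinal\<close> is strict: \<open>x\<close> lies properly below
          some \<open>k\<close>, so the restriction for \<open>k\<close> records
          \<open>f x\<close>.\<close>
        then obtain k where k: "k \<in> K" "x \<in> underS \<kappa> k"
          using K(2) unfolding cofinal_def underS_def by blast
        then show ?thesis
          using fun_cong[OF fun_cong[OF eq, of k], of x] by simp
      next
        case False
        then show ?thesis
          using f g by (simp add: Func_def)
      qed
    qed
    show "?\<phi> f \<in> Func K ?R" if f: "f \<in> Func (Field \<kappa>) (Field \<rho>)" for f
    proof -
      have "(\<lambda>x. if x \<in> underS \<kappa> k then f x else undefined) \<in> Func (underS \<kappa> k) (Field \<rho>)" for k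
        using f by (auto simp: Func_def underS_def intro: FieldI1)
      then show ?thesis
        by (auto simp: Func_def)
    qed
  qed
  then have "\<rho> ^c \<kappa> \<le>o |?R| ^c |K|"
    by (simp add: cexp_def Field_card_of)
  also have "|?R| ^c |K| \<le>o \<rho> ^c |K|"
    by (rule cexp_mono1[OF R card_of_Card_order])
  also have "\<rho> ^c |K| \<le>o \<rho>"
    by (rule pow[OF K_less])
  finally show ?thesis .
qed

text \<open>A proper initial segment of the successor of \<open>\<kappa>\<close> has size at most
  \<open>\<kappa>\<close>. So in the singular case only the exponent \<open>\<kappa>\<close> is new,
  and \<open>cexp_singular_le\<close> handles it.\<close>

lemma regular_majorant:
  fixes \<kappa> :: "'k rel" and \<rho> :: "'r rel"
  assumes \<kappa>: "Cinfinite \<kappa>" and \<rho>: "Cinfinite \<rho>"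
    and pow: "\<And>\<nu> :: 'k rel. Card_order \<nu> \<Longrightarrow> \<nu> <o \<kappa> \<Longrightarrow> \<rho> ^c \<nu> \<le>o \<rho>"
  obtains \<theta> :: "'k set rel" where "closing_off_cardinals \<theta> \<rho>" "\<kappa> \<le>o \<theta>"
proof (cases "regularCard \<kappa>")
  case True
  \<comment> \<open>a copy of \<open>\<kappa>\<close> on the type of \<^const>\<open>cardSuc\<close> \<open>\<kappa>\<close>\<close>
  let ?\<theta> = "|(\<lambda>x. {x}) ` Field \<kappa>|"
  have "|Field \<kappa>| =o ?\<theta>"
    by (intro card_of_ordIsoI[of "\<lambda>x. {x}"] inj_on_imp_bij_betw) simp
  then have iso: "\<kappa> =o ?\<theta>"
    using \<kappa> ordIso_transitive[OF ordIso_symmetric[OF card_of_Field_ordIso]] by blast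
  have "closing_off_cardinals ?\<theta> \<rho>"
  proof
    show "Cinfinite ?\<theta>"
      by (rule Cinfinite_cong[OF iso \<kappa>])
    show "regularCard ?\<theta>"
      by (rule regularCard_ordIso[OF iso \<kappa> True])
    show "\<rho> ^c |underS ?\<theta> i| \<le>o \<rho>" if "i \<in> Field ?\<theta>" for i
    proof (rule cexp_le_of_less[of \<kappa>])
      show "|underS ?\<theta> i| <o \<kappa>"
        using ordLess_ordIso_trans[OF card_of_underS[OF card_of_Card_order] ordIso_symmetric[OF iso]]
          that by (simp add: Field_card_of)
    qed (use \<kappa> \<rho> pow in auto)
  qed (use \<rho> in auto)
  with iso show thesis
    using that ordIso_imp_ordLeq by blast
next
  case False
  let ?\<theta> = "cardSuc \<kappa>"
  have pow': "\<rho> ^c |B| \<le>o \<rho>" if "|B| <o \<kappa>" for B :: "'b set"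
    using cexp_le_of_less[OF _ _ pow that] \<kappa> \<rho> by blast
  have "\<rho> ^c \<kappa> \<le>o \<rho>"
    using cexp_singular_le[OF _ False \<rho> pow'] \<kappa> by blast
  have "closing_off_cardinals ?\<theta> \<rho>"
  proof
    show "Cinfinite ?\<theta>"
      by (rule Cinfinite_cardSuc[OF \<kappa>])
    show "regularCard ?\<theta>"
      by (rule regularCard_cardSuc[OF \<kappa>])
    show "\<rho> ^c |underS ?\<theta> i| \<le>o \<rho>" if "i \<in> Field ?\<theta>" for i
    proof -
      have "|underS ?\<theta> i| <o ?\<theta>"
        using that \<kappa> by (intro card_of_underS cardSuc_Card_order) auto
      then have "|underS ?\<theta> i| \<le>o \<kappa>"
        using cardSuc_ordLeq_ordLess[OF _ card_of_Card_order] \<kappa> by blast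
      then consider "|underS ?\<theta> i| <o \<kappa>" | "|underS ?\<theta> i| =o \<kappa>"
        using ordLeq_iff_ordLess_or_ordIso by blast
      then show ?thesis
      proof cases
        case 1
        then show ?thesis by (rule pow')
      next
        case 2
        then have "\<rho> ^c |underS ?\<theta> i| =o \<rho> ^c \<kappa>"
          using \<kappa> \<rho> by (intro cexp_cong2 card_of_Card_order) auto
        then show ?thesis
          using \<open>\<rho> ^c \<kappa> \<le>o \<rho>\<close> by (rule ordIso_ordLeq_trans)
      qed
    qed
  qed (use \<rho> in auto)
  moreover have "\<kappa> \<le>o ?\<theta>"
    using \<kappa> by (intro cardSuc_ordLeq) auto
  ultimately show thesis
    by (rule that)
qed

section \<open>Properties of the cardinals defined by minimality\<close>

lemma cexp_le_cexp_less:
  fixes \<rho> :: "'r rel" and \<kappa> \<nu> :: "'k rel"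
  assumes "Card_order \<nu>" "\<nu> <o \<kappa>"
  shows "\<rho> ^c \<nu> \<le>o \<rho> ^<c \<kappa>"
proof -
  let ?R = "{\<rho> ^c \<nu> | \<nu> :: 'k rel. Card_order \<nu> \<and> \<nu> <o \<kappa>}"
  have "\<forall>r\<in>?R. r \<le>o card_sup ?R"
    unfolding card_sup_def
  proof (rule card_least(2)[where P = "\<lambda>c. \<forall>r\<in>?R. r \<le>o c"])
    show "Card_order |UNIV :: ('k \<Rightarrow> 'r) set|"
      by (rule card_of_Card_order)
    show "\<forall>r\<in>?R. r \<le>o |UNIV :: ('k \<Rightarrow> 'r) set|"
      by (rule card_sup_exists) (auto simp: Card_order_cexp)
  qed
  then show ?thesis
    using assms unfolding cexp_less_def by blast
qed

lemma F_hat: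
  fixes X :: "'a topology"
  shows "Card_order (F_hat X)" "free_in X S \<Longrightarrow> |S| <o F_hat X"
proof -
  let ?P = "\<lambda>\<phi> :: 'a set rel. \<forall>S. free_in X S \<longrightarrow> |S| <o \<phi>"
  have *: "?P |UNIV :: 'a set set|"
    using F_hat_exists by blast
  show "Card_order (F_hat X)"
    unfolding F_hat_def by (rule card_least(1)[where P = ?P, OF card_of_Card_order *])
  show "free_in X S \<Longrightarrow> |S| <o F_hat X"
    using card_least(2)[where P = ?P, OF card_of_Card_order *]
    unfolding F_hat_def by blast
qed

lemma mu_hat:
  fixes X :: "'a topology"
  shows "Card_order (mu_hat X)"
    and "free_in X S \<Longrightarrow> (\<And>U. U \<in> \<U> \<Longrightarrow> openin X U) \<Longrightarrow> X closure_of S \<subseteq> \<Union>\<U> \<Longrightarrow>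
      \<exists>\<V>\<subseteq>\<U>. |\<V>| <o mu_hat X \<and> X closure_of S \<subseteq> \<Union>\<V>"
proof -
  let ?P = "\<lambda>\<mu> :: 'a set rel. \<forall>S \<U>. free_in X S \<and> (\<forall>U\<in>\<U>. openin X U) \<and> X closure_of S \<subseteq> \<Union>\<U> \<longrightarrow>
     (\<exists>\<V>\<subseteq>\<U>. |\<V>| <o \<mu> \<and> X closure_of S \<subseteq> \<Union>\<V>)"
  have *: "?P |UNIV :: 'a set set|"
    using mu_hat_exists by blast
  show "Card_order (mu_hat X)"
    unfolding mu_hat_def by (rule card_least(1)[where P = ?P, OF card_of_Card_order *])
  have "?P (mu_hat X)"
    unfolding mu_hat_def by (rule card_least(2)[where P = ?P, OF card_of_Card_order *])
  then show "free_in X S \<Longrightarrow> (\<And>U. U \<in> \<U> \<Longrightarrow> openin X U) \<Longrightarrow> X closure_of S \<subseteq> \<Union>\<U> \<Longrightarrow>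
      \<exists>\<V>\<subseteq>\<U>. |\<V>| <o mu_hat X \<and> X closure_of S \<subseteq> \<Union>\<V>"
    by blast
qed

lemma Cnotzero_of_less: "Card_order r \<Longrightarrow> |A| <o r \<Longrightarrow> Cnotzero r"
  by (metis card_of_empty czero_def not_ordLess_ordIso ordIso_symmetric ordLeq_ordLess_trans)

text \<open>An infinite space has finite subsets of every finite size. They are all free, so no
  finite cardinal strictly exceeds the sizes of all free sets.\<close>

lemma Cinfinite_F_hat:
  assumes X: "t1_space X" "infinite (topspace X)"
  shows "Cinfinite (F_hat X)"
proof -
  have "infinite (Field (F_hat X))"
  proof
    assume fin: "finite (Field (F_hat X))"
    obtain S where S: "S \<subseteq> topspace X" "finite S" "card S = card (Field (F_hat X))"
      using infinite_arbitrarily_large[OF X(2)] by blast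
    then have "|S| =o |Field (F_hat X)|"
      using fin finite_same_card_bij card_of_ordIsoI by metis
    then have "|S| =o F_hat X"
      using card_of_Field_ordIso[OF F_hat(1)] ordIso_transitive by blast
    moreover have "|S| <o F_hat X"
      using S by (intro F_hat(2) free_in_finite X(1))
    ultimately show False
      using not_ordLess_ordIso by blast
  qed
  then show ?thesis
    by (simp add: cinfinite_def F_hat(1))
qed

text \<open>The empty set is free and its closure is covered by the empty family, whose size must be
  below \<open>mu_hat X\<close>. A zero factor would prevent the product \<open>\<kappa>\<close>
  from bounding \<open>F_hat X\<close>.\<close>

lemma Cnotzero_mu_hat:
  fixes X :: "'a topology"
  assumes "topspace X \<noteq> {}"
  shows "Cnotzero (mu_hat X)"
proof -
  have "free_in X {}"
    unfolding free_in_def free_sequence_def by (auto intro: exI[of _ "{}"])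
  from mu_hat(2)[OF this, of "{}"] have "|{} :: 'a set set| <o mu_hat X"
    by auto
  then show ?thesis
    by (rule Cnotzero_of_less[OF mu_hat(1)])
qed

text \<open>Induction on the generation of the topology. The intersection of two members corresponds
  to the union of their defining families, which has size less than \<open>\<theta>\<close> because
  \<open>\<theta>\<close> is infinite.\<close>

lemma G_less_topology_neighbourhood:
  assumes \<theta>: "Cinfinite \<theta>" and le: "\<kappa> \<le>o \<theta>"
    and "openin (G_less_topology X \<kappa>) U" "x \<in> U"
  obtains \<O> where "|\<O>| <o \<theta>" "\<And>G. G \<in> \<O> \<Longrightarrow> openin X G" "x \<in> \<Inter>\<O>" "\<Inter>\<O> \<subseteq> U"
proof -
  let ?nb = "\<lambda>x U. \<exists>\<O>. |\<O>| <o \<theta> \<and> (\<forall>G\<in>\<O>. openin X G) \<and> x \<in> \<Inter>\<O> \<and> \<Inter>\<O> \<subseteq> U"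
  have "generate_topology_on (insert (topspace X) {G. G_less X \<kappa> G}) U"
    using assms(3) by (simp add: G_less_topology_def openin_topology_generated_by_iff)
  then have "\<forall>x\<in>U. ?nb x U"
  proof induction
    case (Int A B)
    show ?case
    proof
      fix x assume x: "x \<in> A \<inter> B"
      have "?nb x A"
        using x by (intro bspec[OF Int.IH(1)]) simp
      then obtain \<A> where \<A>: "|\<A>| <o \<theta> \<and> (\<forall>G\<in>\<A>. openin X G) \<and> x \<in> \<Inter>\<A> \<and> \<Inter>\<A> \<subseteq> A"
        by (rule exE)
      have "?nb x B"
        using x by (intro bspec[OF Int.IH(2)]) simp
      then obtain \<B> where \<B>: "|\<B>| <o \<theta> \<and> (\<forall>G\<in>\<B>. openin X G) \<and> x \<in> \<Inter>\<B> \<and> \<Inter>\<B> \<subseteq> B"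
        by (rule exE)
      have "|\<A> \<union> \<B>| <o \<theta>"
        using \<A> \<B> \<theta> by (intro Un_Cinfinite_bound_strict) simp_all
      moreover have "\<Inter>(\<A> \<union> \<B>) = \<Inter>\<A> \<inter> \<Inter>\<B>"
        by (rule Inter_Un_distrib)
      then have "x \<in> \<Inter>(\<A> \<union> \<B>)" "\<Inter>(\<A> \<union> \<B>) \<subseteq> A \<inter> B"
        using \<A> \<B> by (simp_all only:) blast+
      moreover have "\<forall>G\<in>\<A> \<union> \<B>. openin X G"
        using \<A> \<B> by blast
      ultimately show "?nb x (A \<inter> B)"
        by (intro exI[of _ "\<A> \<union> \<B>"] conjI)
    qed
  next
    case (UN K)
    show ?case
    proof
      fix x assume "x \<in> \<Union>K"
      then obtain A where A: "A \<in> K" "x \<in> A"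
        by blast
      have "?nb x A"
        using A UN by blast
      then show "?nb x (\<Union>K)"
        using subset_trans[OF _ Union_upper[OF A(1)]] by (elim ex_forward conj_forward) simp_all
    qed
  next
    case (Basis G)
    then consider "G = topspace X" | "G_less X \<kappa> G"
      by blast
    then obtain \<U> where \<U>: "|\<U>| <o \<theta>" "\<forall>U\<in>\<U>. openin X U" "G = topspace X \<inter> \<Inter>\<U>"
    proof cases
      case 1
      then show thesis
        using that[of "{}"] finite_card_less[OF \<theta>, of "{}"] by simp
    next
      case 2
      then show thesis
        using that ordLess_ordLeq_trans[OF _ le] unfolding G_less_def by blast
    qed
    \<comment> \<open>\<open>topspace X\<close> is inserted because \<open>\<Inter>{}\<close> is \<^const>\<open>UNIV\<close>\<close>
    have "|insert (topspace X) \<U>| <o \<theta>"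
      using Un_Cinfinite_bound_strict[OF finite_card_less[OF \<theta>, of "{topspace X}"] \<U>(1) \<theta>] by simp
    then show ?case
      using \<U>(2,3) by (intro ballI exI[of _ "insert (topspace X) \<U>"]) auto
  qed simp
  with assms(4) that show thesis
    by blast
qed

theorem theorem0p1:
  fixes X :: "'a topology"
    and \<kappa> :: "('a set \<times> 'a set) rel"
    and \<rho> :: "'r rel"
  assumes "Hausdorff_space X"
    and "\<kappa> = F_hat X *c mu_hat X"
    and "Cinfinite \<rho>"
    and "\<rho> ^<c \<kappa> =o \<rho>"
  shows "lindelof_number (G_less_topology X \<kappa>) \<le>o \<rho>"
proof -
  let ?Y = "G_less_topology X \<kappa>"
  have subcover: "\<exists>\<V>\<subseteq>\<U>. |\<V>| \<le>o \<rho> \<and> \<Union>\<V> = topspace ?Y"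
    if op: "\<forall>U\<in>\<U>. openin ?Y U" and cov: "\<Union>\<U> = topspace ?Y" for \<U>
  proof (cases "finite (topspace X)")
    \<comment> \<open>For finite \<open>X\<close> the cardinal \<open>\<kappa>\<close> is finite, so
      \<open>regular_majorant\<close> does not apply; one member of the cover per point
      suffices.\<close>
    case True
    obtain \<V> where \<V>: "\<V> \<subseteq> \<U>" "|\<V>| \<le>o |topspace ?Y|" "topspace ?Y \<subseteq> \<Union>\<V>"
      using subcover_exists[of "topspace ?Y" \<U>] cov by auto
    have "|topspace ?Y| \<le>o \<rho>"
      using finite_card_less[OF assms(3) True]
      by (simp add: topspace_G_less_topology ordLess_imp_ordLeq)
    with \<V>(2) have "|\<V>| \<le>o \<rho>"
      by (rule ordLeq_transitive)
    with \<V> cov show ?thesis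
      by blast
  next
    case False
    have F_inf: "Cinfinite (F_hat X)"
      using False assms(1) Hausdorff_imp_t1_space by (intro Cinfinite_F_hat) auto
    have mu_pos: "Cnotzero (mu_hat X)"
      using False by (intro Cnotzero_mu_hat) auto
    have F_le: "F_hat X \<le>o \<kappa>"
      using ordIso_imp_ordLeq[OF cprod_com] ordLeq_cprod2[OF mu_pos F_hat(1)] ordLeq_transitive
      unfolding assms(2) by blast
    have mu_le: "mu_hat X \<le>o \<kappa>"
      unfolding assms(2) using F_inf mu_hat(1) by (intro ordLeq_cprod2 Cinfinite_Cnotzero) auto
    have "Card_order \<kappa>"
      unfolding assms(2) by (rule Card_order_cprod)
    then have \<kappa>_inf: "Cinfinite \<kappa>"
      using cinfinite_mono[OF F_le] F_inf by blast
    have "\<rho> ^c \<nu> \<le>o \<rho>" if "Card_order \<nu>" "\<nu> <o \<kappa>" for \<nu> :: "('a set \<times> 'a set) rel"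
      using cexp_le_cexp_less[OF that] assms(4) by (rule ordLeq_ordIso_trans)
    then obtain \<theta> :: "('a set \<times> 'a set) set rel"
      where \<theta>: "closing_off_cardinals \<theta> \<rho>" "\<kappa> \<le>o \<theta>"
      by (rule regular_majorant[OF \<kappa>_inf assms(3)])
    interpret closing_off_cardinals \<theta> \<rho>
      by (rule \<theta>(1))
    \<comment> \<open>Members of the cover are only unions of intersections of small families. The
      cover is therefore refined to such intersections, and \<open>u\<close> below leads back to
      \<open>\<U>\<close>.\<close>
    define \<C> where "\<C> = {\<O>. |\<O>| <o \<theta> \<and> (\<forall>G\<in>\<O>. openin X G) \<and> (\<exists>U\<in>\<U>. \<Inter>\<O> \<subseteq> U)}"
    obtain \<D> where \<D>: "\<D> \<subseteq> \<C>" "|\<D>| \<le>o \<rho>" "topspace X \<subseteq> (\<Union>\<O>\<in>\<D>. \<Inter>\<O>)"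
    proof (rule Lindelof_G_less[OF assms(1), of \<C>])
      show "|S| <o \<theta>" if "free_in X S" for S
        using ordLess_ordLeq_trans[OF F_hat(2)[OF that] ordLeq_transitive[OF F_le \<theta>(2)]] .
      show "\<exists>\<V>\<in>Pow_less \<theta> \<W>. X closure_of S \<subseteq> \<Union>\<V>"
        if S: "free_in X S" "\<And>U. U \<in> \<W> \<Longrightarrow> openin X U" "X closure_of S \<subseteq> \<Union>\<W>" for S \<W>
      proof -
        obtain \<V> where \<V>: "\<V> \<subseteq> \<W>" "|\<V>| <o mu_hat X" "X closure_of S \<subseteq> \<Union>\<V>"
          using mu_hat(2)[OF S] by blast
        have "|\<V>| <o \<theta>"
          by (rule ordLess_ordLeq_trans[OF \<V>(2) ordLeq_transitive[OF mu_le \<theta>(2)]])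
        with \<V> show ?thesis
          by (auto simp: Pow_less_def)
      qed
      show "topspace X \<subseteq> (\<Union>\<O>\<in>\<C>. \<Inter>\<O>)"
      proof
        fix x assume "x \<in> topspace X"
        then obtain U where U: "U \<in> \<U>" "x \<in> U"
          using cov by (auto simp: topspace_G_less_topology)
        then obtain \<O> where "|\<O>| <o \<theta>" "\<And>G. G \<in> \<O> \<Longrightarrow> openin X G" "x \<in> \<Inter>\<O>" "\<Inter>\<O> \<subseteq> U"
          using G_less_topology_neighbourhood[OF theta_infinite \<theta>(2), of X U x] op by blast
        then have "\<O> \<in> \<C>" "x \<in> \<Inter>\<O>"
          using U(1) unfolding \<C>_def by blast+
        then show "x \<in> (\<Union>\<O>\<in>\<C>. \<Inter>\<O>)"
          by blast
      qed
    qed (auto simp: \<C>_def)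
    have "\<forall>\<O>\<in>\<D>. \<exists>U. U \<in> \<U> \<and> \<Inter>\<O> \<subseteq> U"
      using \<D>(1) unfolding \<C>_def by blast
    from bchoice[OF this] obtain u where u: "\<forall>\<O>\<in>\<D>. u \<O> \<in> \<U> \<and> \<Inter>\<O> \<subseteq> u \<O>" ..
    show ?thesis
    proof (intro exI[of _ "u ` \<D>"] conjI)
      show "u ` \<D> \<subseteq> \<U>"
        using u by blast
      show "|u ` \<D>| \<le>o \<rho>"
        by (rule image_le_rho[OF \<D>(2)])
      show "\<Union>(u ` \<D>) = topspace ?Y"
      proof
        show "\<Union>(u ` \<D>) \<subseteq> topspace ?Y"
          using u cov by blast
        show "topspace ?Y \<subseteq> \<Union>(u ` \<D>)"
        proof
          fix x assume "x \<in> topspace ?Y"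
          then have "x \<in> (\<Union>\<O>\<in>\<D>. \<Inter>\<O>)"
            using \<D>(3) unfolding topspace_G_less_topology by (rule rev_subsetD)
          then obtain \<O> where \<O>: "\<O> \<in> \<D>" "x \<in> \<Inter>\<O>"
            by (rule UN_E)
          moreover have "\<Inter>\<O> \<subseteq> u \<O>"
            using bspec[OF u \<O>(1)] by (rule conjunct2)
          ultimately show "x \<in> \<Union>(u ` \<D>)"
            by (meson UN_I subsetD)
        qed
      qed
    qed
  qed
  show ?thesis
    unfolding lindelof_number_def
  \<comment> \<open>\<open>\<rho>\<close> may live on another type than the Lindelof number, so the
    covering property is checked for the copies of \<open>\<rho>\<close> on that type.\<close>
  proof (rule card_least_le[where c = "|UNIV :: ('a + nat) set|"])
    show "Card_order \<rho>"
      using assms(3) by blast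
    fix d' :: "('a + nat) rel"
    assume d': "Card_order d'" "d' =o \<rho>"
    have "Cinfinite d'"
      by (rule Cinfinite_cong[OF ordIso_symmetric[OF d'(2)] assms(3)])
    moreover have "|\<V>| \<le>o d'" if "|\<V>| \<le>o \<rho>" for \<V> :: "'a set set"
      by (rule ordLeq_ordIso_trans[OF that ordIso_symmetric[OF d'(2)]])
    ultimately show "Cinfinite d' \<and> (\<forall>\<U>. (\<forall>U\<in>\<U>. openin ?Y U) \<and> \<Union>\<U> = topspace ?Y \<longrightarrow>
       (\<exists>\<V>\<subseteq>\<U>. |\<V>| \<le>o d' \<and> \<Union>\<V> = topspace ?Y))"
      using subcover by meson
  qed (use lindelof_number_exists in auto)
qed

end
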